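(* Let $k\ge 1$ and $d\ge 0$ be integers, and consider Bonus Eggs starting with $k$ eggs. If $d<k$, the Bonus Eggs tree of depth $d$ has $2^d$ leaves and $2^d-1$ inner nodes. If $k\le d$, set $$\alpha=\left\lfloor\frac{d-k}{2}\right\rfloor,\qquad \beta=\left\lfloor\frac{d-k+1}{2}\right\rfloor.$$ Then the Bonus Eggs tree of depth $d$ has $$Z_k(d)=\sum_{m=0}^{\alpha}\frac{k}{2m+k}\binom{2m+k}{m}$$ leaves with no remaining eggs and $$M_k(d)=\sum_{n=\beta}^{\beta+k-1}\binom{d}{n}$$ leaves that still have eggs. The height $H_{\mathcal B,k}(d)$ of the tallest building for which the strength of the eggs can be determined starting with $k$ eggs and using no more than $d$ egg drops is $2^d-1$ when $d<k$, and when $k\le d$ it is $$H_{\mathcal B,k}(d)=\sum_{m=1}^{\alpha}\frac{k}{2m+k}\binom{2m+k}{m}+\sum_{n=\beta}^{\beta+k-1}\binom{d}{n}.$$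
   Context: Egg-drop problem: a building has floors $1,\dots,N$ (its height is $N$) and all eggs have the same unknown strength $s\in\{0,1,\dots,N\}$, every value being possible. An egg dropped from floor $x\in\{1,\dots,N\}$ survives if $x\le s$ and breaks if $x>s$. One starts with $k$ eggs; a drop can be made only if at least one egg is in hand; the floor of each drop may be chosen depending on the outcomes of the previous drops. Bonus Eggs: each time an egg breaks the number of eggs in hand decreases by one, and each time a dropped egg does not break one new egg is received, so the number of eggs in hand increases by one. $H_{\mathcal B,k}(d)$ is the largest $N$ for which there is a deterministic adaptive strategy, obeying these egg-supply rules, that determines $s$ using at most $d$ drops for every possible $s\in\{0,1,\dots,N\}$. The Bonus Eggs tree of depth $d$ starting with $k$ eggs is the binary tree whose nodes carry a number of remaining eggs, defined as follows: the root (at depth $0$) has $k$ eggs; every node at depth less than $d$ with at least one egg is an inner node with two children, the left child having one fewer egg than its parent and the right child having one more egg than its parent; every node with $0$ eggs and every node at depth $d$ is a leaf. Empty sums are $0$. *)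

theory Defs
  imports Complex_Main
begin

text \<open>
  A deterministic adaptive strategy is a decision tree: either announce a strength, or drop an egg
  from floor \<open>x\<close> and continue with the first subtree if the egg breaks and with the second one if it
  survives. Finite trees suffice, since only strategies with a uniform bound on the number of drops
  are considered.
\<close>

datatype strategy = Announce nat | Drop nat strategy strategy

fun announced :: "strategy \<Rightarrow> nat \<Rightarrow> nat" where
  "announced (Announce a) s = a"
| "announced (Drop x b v) s = (if x \<le> s then announced v s else announced b s)"

fun drops_used :: "strategy \<Rightarrow> nat \<Rightarrow> nat" where
  "drops_used (Announce a) s = 0"
| "drops_used (Drop x b v) s = Suc (if x \<le> s then drops_used v s else drops_used b s)"

text \<open>
  \<open>obeys_bonus N k \<sigma> s\<close>: executing \<open>\<sigma>\<close> with eggs of strength \<open>s\<close> in a building of height \<open>N\<close>, with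
  \<open>k\<close> eggs in hand, only uses existing floors and never drops an egg when none is in hand.
\<close>

fun obeys_bonus :: "nat \<Rightarrow> nat \<Rightarrow> strategy \<Rightarrow> nat \<Rightarrow> bool" where
  "obeys_bonus N k (Announce a) s \<longleftrightarrow> True"
| "obeys_bonus N k (Drop x b v) s \<longleftrightarrow>
     1 \<le> x \<and> x \<le> N \<and> 1 \<le> k \<and>
     (if x \<le> s then obeys_bonus N (k + 1) v s else obeys_bonus N (k - 1) b s)"

definition solvable_bonus :: "nat \<Rightarrow> nat \<Rightarrow> nat \<Rightarrow> bool" where
  "solvable_bonus k d N \<longleftrightarrow>
     (\<exists>\<sigma>. \<forall>s\<in>{0..N}. obeys_bonus N k \<sigma> s \<and> drops_used \<sigma> s \<le> d \<and> announced \<sigma> s = s)"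

definition H_bonus :: "nat \<Rightarrow> nat \<Rightarrow> nat" where
  "H_bonus k d = (GREATEST N. solvable_bonus k d N)"

text \<open>The maximum defining \<open>H_bonus\<close> exists: \<open>d\<close> drops distinguish at most \<open>2 ^ d\<close> strengths.\<close>

lemma card_announced_le:
  "finite (announced \<sigma> ` {s. drops_used \<sigma> s \<le> d}) \<and>
   card (announced \<sigma> ` {s. drops_used \<sigma> s \<le> d}) \<le> 2 ^ d"
proof (induction \<sigma> arbitrary: d)
  case (Announce a)
  have "announced (Announce a) ` {s. drops_used (Announce a) s \<le> d} = {a}" by auto
  then show ?case by simp
next
  case (Drop x b v)
  show ?case
  proof (cases d)
    case 0
    then show ?thesis by simp
  next
    case (Suc e)
    let ?B = "announced b ` {s. drops_used b s \<le> e}"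
    let ?V = "announced v ` {s. drops_used v s \<le> e}"
    have sub: "announced (Drop x b v) ` {s. drops_used (Drop x b v) s \<le> d} \<subseteq> ?B \<union> ?V"
      using Suc by (auto split: if_splits)
    have fin: "finite (?B \<union> ?V)" using Drop.IH by simp
    have "card (?B \<union> ?V) \<le> card ?B + card ?V" by (rule card_Un_le)
    also have "\<dots> \<le> 2 ^ e + 2 ^ e" using Drop.IH by (intro add_mono) auto
    finally have "card (?B \<union> ?V) \<le> 2 ^ d" using Suc by simp
    then show ?thesis
      using finite_subset[OF sub fin] card_mono[OF fin sub] by linarith
  qed
qed

lemma solvable_bonus_bound:
  assumes "solvable_bonus k d N"
  shows "N < 2 ^ d"
proof -
  obtain \<sigma> where s: "\<And>s. s \<in> {0..N} \<Longrightarrow> drops_used \<sigma> s \<le> d \<and> announced \<sigma> s = s"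
    using assms unfolding solvable_bonus_def by blast
  have "{0..N} \<subseteq> announced \<sigma> ` {s. drops_used \<sigma> s \<le> d}"
    using s by (force simp: image_iff)
  then have "card {0..N} \<le> 2 ^ d"
    using card_announced_le[of \<sigma> d] card_mono le_trans by blast
  then show ?thesis by simp
qed

lemma solvable_bonus_0: "solvable_bonus k d 0"
  unfolding solvable_bonus_def by (intro exI[of _ "Announce 0"]) simp

lemma H_bonus_greatest:
  "solvable_bonus k d (H_bonus k d)"
  "solvable_bonus k d N \<Longrightarrow> N \<le> H_bonus k d"
proof -
  have b: "\<forall>y. solvable_bonus k d y \<longrightarrow> y \<le> 2 ^ d"
    using solvable_bonus_bound less_imp_le by blast
  show "solvable_bonus k d (H_bonus k d)"
    unfolding H_bonus_def
    using GreatestI_nat[of "solvable_bonus k d" 0 "2 ^ d"] solvable_bonus_0 b by blast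
  show "solvable_bonus k d N \<Longrightarrow> N \<le> H_bonus k d"
    unfolding H_bonus_def using Greatest_le_nat b by blast
qed

text \<open>Binary trees all of whose nodes carry a number of remaining eggs.\<close>

datatype egg_tree = Leaf nat | Inner nat egg_tree egg_tree

text \<open>In the recursion the first argument is the remaining depth.\<close>

fun bonus_tree :: "nat \<Rightarrow> nat \<Rightarrow> egg_tree" where
  "bonus_tree 0 k = Leaf k"
| "bonus_tree (Suc d) k =
     (if k = 0 then Leaf 0 else Inner k (bonus_tree d (k - 1)) (bonus_tree d (k + 1)))"

fun num_inner :: "egg_tree \<Rightarrow> nat" where
  "num_inner (Leaf e) = 0"
| "num_inner (Inner e l r) = Suc (num_inner l + num_inner r)"

text \<open>The egg numbers at the leaves, from left to right (with repetitions).\<close>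

fun leaf_eggs :: "egg_tree \<Rightarrow> nat list" where
  "leaf_eggs (Leaf e) = [e]"
| "leaf_eggs (Inner e l r) = leaf_eggs l @ leaf_eggs r"

definition num_leaves :: "egg_tree \<Rightarrow> nat" where
  "num_leaves t = length (leaf_eggs t)"

definition num_leaves_without_eggs :: "egg_tree \<Rightarrow> nat" where
  "num_leaves_without_eggs t = length (filter (\<lambda>e. e = 0) (leaf_eggs t))"

definition num_leaves_with_eggs :: "egg_tree \<Rightarrow> nat" where
  "num_leaves_with_eggs t = length (filter (\<lambda>e. e > 0) (leaf_eggs t))"

end

theory Submission
  imports Defs
begin

text \<open>
  Without the branches that no strength takes, a strategy with \<open>d\<close> drops and \<open>k\<close> eggs is a decision
  tree that embeds in the Bonus Eggs tree, with breaking as left and surviving as right. The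
  strengths it tells apart end in distinct leaves, so there are at most as many as the Bonus Eggs
  tree has leaves (\<open>card_identified_le_num_leaves\<close>).
  Conversely, the in-order numbering of the inner nodes turns the whole tree into a search tree,
  that is, into a strategy for consecutive strengths (\<open>bonus_tree_strategy\<close>). In a binary tree the
  leaves outnumber the inner nodes by one, so the maximal height is the number of inner nodes, or
  the number of leaves minus one.

  The leaves are then counted as walks on the integers that start at \<open>k\<close>, move by \<open>\<plusminus>1\<close> and are
  absorbed at \<open>0\<close>. A leaf without eggs is a walk that hits \<open>0\<close> for the first time at some time
  \<open>2 * m + k \<le> d\<close>, after \<open>m\<close> steps up and \<open>m + k\<close> steps down; the number of these is the ballot
  number \<open>k / (2 * m + k) * ((2 * m + k) choose m)\<close>. A leaf with eggs is a walk of length \<open>d\<close> that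
  avoids \<open>0\<close>. By the reflection principle their number is the number of all walks of length \<open>d\<close>
  ending at a positive place minus the number of those ending at a negative one. With \<open>n\<close> steps down
  the end is \<open>k + d - 2 * n\<close>, so the first are counted by the \<open>d choose n\<close> with \<open>2 * n < d + k\<close>; by the
  symmetry of the binomial coefficients, the second are counted by those with \<open>2 * n < d - k\<close>. A
  window of \<open>k\<close> consecutive binomial coefficients is left when \<open>k \<le> d\<close>. Both counts are verified by
  induction on \<open>d\<close> from the recursion of the tree. The term \<open>m = 0\<close> of the first
  count is \<open>1\<close>; dropping it from the sum accounts for the minus one in the height.
\<close>

section \<open>Strategies and the leaves of the tree\<close>

lemma num_leaves_simps [simp]:
  "num_leaves (Leaf e) = 1"
  "num_leaves (Inner e l r) = num_leaves l + num_leaves r"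
  by (simp_all add: num_leaves_def)

lemma num_leaves_eq_Suc_num_inner: "num_leaves t = Suc (num_inner t)"
  by (induction t) auto

lemma num_leaves_split:
  "num_leaves t = num_leaves_without_eggs t + num_leaves_with_eggs t"
  using sum_length_filter_compl[of "\<lambda>e. e = 0" "leaf_eggs t"]
  by (simp add: num_leaves_def num_leaves_without_eggs_def num_leaves_with_eggs_def)

text \<open>
  The first drop splits \<open>S\<close> into the strengths below and above the floor, which are handled by the
  two subtrees. Arbitrary finite sets \<open>S\<close>, in place of intervals, also cover strategies that waste
  drops: one of the two parts may be empty.
\<close>

lemma card_identified_le_num_leaves:
  assumes "finite S"
    and "\<forall>s\<in>S. obeys_bonus N k \<sigma> s \<and> drops_used \<sigma> s \<le> d \<and> announced \<sigma> s = s"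
  shows "card S \<le> num_leaves (bonus_tree d k)"
  using assms
proof (induction \<sigma> arbitrary: S k d)
  case (Announce a)
  then have "S \<subseteq> {a}" by auto
  then have "card S \<le> 1" using card_mono[of "{a}" S] by simp
  then show ?case by (simp add: num_leaves_eq_Suc_num_inner)
next
  case (Drop x b v)
  show ?case
  proof (cases "S = {}")
    case True
    then show ?thesis by simp
  next
    case False
    then obtain s where "s \<in> S" by blast
    with Drop.prems have "1 \<le> k" "0 < d" by force+
    then obtain e where d: "d = Suc e" using gr0_implies_Suc by blast
    have below: "card {s\<in>S. s < x} \<le> num_leaves (bonus_tree e (k - 1))"
      using Drop.prems d by (intro Drop.IH(1)) force+
    have above: "card {s\<in>S. x \<le> s} \<le> num_leaves (bonus_tree e (k + 1))"
      using Drop.prems d by (intro Drop.IH(2)) force+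
    have "S = {s\<in>S. s < x} \<union> {s\<in>S. x \<le> s}" by auto
    then have "card S \<le> card {s\<in>S. s < x} + card {s\<in>S. x \<le> s}"
      using card_Un_le by metis
    with below above d \<open>1 \<le> k\<close> show ?thesis by simp
  qed
qed

text \<open>
  The root is numbered after all inner nodes of its left subtree, so the first egg is dropped from
  floor \<open>lo + num_inner l + 1\<close>. The strengths below are then as many as the leaves on the left, and
  the remaining ones as many as the leaves on the right.
\<close>

lemma bonus_tree_strategy:
  assumes "lo + num_inner (bonus_tree d k) \<le> N"
  shows "\<exists>\<sigma>. \<forall>s\<in>{lo..lo + num_inner (bonus_tree d k)}.
           obeys_bonus N k \<sigma> s \<and> drops_used \<sigma> s \<le> d \<and> announced \<sigma> s = s"
  using assms
proof (induction d k arbitrary: lo rule: bonus_tree.induct)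
  case (1 k)
  show ?case by (intro exI[of _ "Announce lo"]) simp
next
  case (2 d k)
  show ?case
  proof (cases "k = 0")
    case True
    then show ?thesis by (intro exI[of _ "Announce lo"]) simp
  next
    case False
    define l where "l = num_inner (bonus_tree d (k - 1))"
    define r where "r = num_inner (bonus_tree d (k + 1))"
    define x where "x = lo + l + 1"
    have n: "num_inner (bonus_tree (Suc d) k) = Suc (l + r)"
      using False by (simp add: l_def r_def)
    with 2 have N: "x + r \<le> N" by (simp add: x_def)
    obtain b where b: "\<forall>s\<in>{lo..lo + l}.
        obeys_bonus N (k - 1) b s \<and> drops_used b s \<le> d \<and> announced b s = s"
      using "2.IH"(1)[OF False, of lo] N unfolding l_def x_def by auto
    obtain v where v: "\<forall>s\<in>{x..x + r}.
        obeys_bonus N (k + 1) v s \<and> drops_used v s \<le> d \<and> announced v s = s"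
      using "2.IH"(2)[OF False, of x] N unfolding r_def by auto
    show ?thesis
      unfolding n
    proof (intro exI[of _ "Drop x b v"] ballI)
      fix s assume s: "s \<in> {lo..lo + Suc (l + r)}"
      show "obeys_bonus N k (Drop x b v) s \<and> drops_used (Drop x b v) s \<le> Suc d \<and>
            announced (Drop x b v) s = s"
      proof (cases "x \<le> s")
        case True
        with s have "s \<in> {x..x + r}" by (simp add: x_def)
        with v True N False show ?thesis by (simp add: x_def)
      next
        case below: False
        with s have "s \<in> {lo..lo + l}" by (simp add: x_def)
        with b below N False show ?thesis by (simp add: x_def)
      qed
    qed
  qed
qed

lemma H_bonus_eq_num_inner: "H_bonus k d = num_inner (bonus_tree d k)"
proof (rule antisym)
  obtain \<sigma> where "\<forall>s\<in>{0..H_bonus k d}.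
      obeys_bonus (H_bonus k d) k \<sigma> s \<and> drops_used \<sigma> s \<le> d \<and> announced \<sigma> s = s"
    using H_bonus_greatest(1) unfolding solvable_bonus_def by blast
  then have "card {0..H_bonus k d} \<le> num_leaves (bonus_tree d k)"
    by (rule card_identified_le_num_leaves[rotated]) simp
  then show "H_bonus k d \<le> num_inner (bonus_tree d k)"
    by (simp add: num_leaves_eq_Suc_num_inner)
next
  have "solvable_bonus k d (num_inner (bonus_tree d k))"
    using bonus_tree_strategy[of 0] unfolding solvable_bonus_def by simp
  then show "num_inner (bonus_tree d k) \<le> H_bonus k d"
    by (rule H_bonus_greatest(2))
qed

text \<open>As long as \<open>d \<le> k\<close>, the eggs cannot run out above depth \<open>d\<close>, and the tree is complete.\<close>

lemma num_leaves_complete: "d \<le> k \<Longrightarrow> num_leaves (bonus_tree d k) = 2 ^ d"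
  by (induction d arbitrary: k) auto

section \<open>Leaves without eggs\<close>

text \<open>
  The number of walks from \<open>k\<close> that reach \<open>0\<close> for the first time after \<open>m\<close> steps up and \<open>m + k\<close>
  steps down. The walk of length zero from \<open>0\<close> counts once, a case in which the quotient formula
  would be \<open>0 / 0 = 0\<close>; hence the case distinction.
\<close>

definition ballot_number :: "nat \<Rightarrow> nat \<Rightarrow> real" where
  "ballot_number m k =
     (if m = 0 then 1 else real k / real (2 * m + k) * real ((2 * m + k) choose m))"

lemma ballot_number_0 [simp]: "ballot_number 0 k = 1"
  by (simp add: ballot_number_def)

lemma ballot_number_start_0: "ballot_number m 0 = (if m = 0 then 1 else 0)"
  by (simp add: ballot_number_def)

lemma ballot_number_eq:
  "k \<ge> 1 \<Longrightarrow> ballot_number m k = real k / real (2 * m + k) * real ((2 * m + k) choose m)"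
  by (simp add: ballot_number_def)

text \<open>
  Decomposition by the first step. All three binomial coefficients involved are multiples of
  \<open>t = (n choose m) / (m + 1)\<close> with \<open>n = 2 * m + k + 2\<close>, and the claim becomes a polynomial
  identity.
\<close>

lemma ballot_number_Suc:
  "ballot_number (Suc m) (Suc k) = ballot_number (Suc m) k + ballot_number m (k + 2)"
proof -
  define n where "n = 2 * m + k + 2"
  define t where "t = real (n choose m) / (real m + 1)"
  have low: "real (n choose m) = (real m + 1) * t"
    by (simp add: t_def)
  have "Suc m * (n choose Suc m) = (n - m) * (n choose m)"
    by (metis binomial_absorb_comp binomial_absorption)
  then have "real (Suc m * (n choose Suc m)) = real ((m + k + 2) * (n choose m))"
    by (simp add: n_def)
  then have "(real m + 1) * real (n choose Suc m) = (real m + 1) * ((real m + real k + 2) * t)"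
    using low by (simp add: algebra_simps)
  then have high: "real (n choose Suc m) = (real m + real k + 2) * t"
    by (simp add: add_nonneg_eq_0_iff)
  have sum: "real (Suc n choose Suc m) = (2 * real m + real k + 3) * t"
    using low high by (simp add: algebra_simps)
  have "ballot_number (Suc m) (Suc k) = (real k + 1) * t"
  proof -
    have "ballot_number (Suc m) (Suc k) = real (Suc k) / real (Suc n) * real (Suc n choose Suc m)"
      by (simp add: ballot_number_def n_def)
    also have "real (Suc n) = 2 * real m + real k + 3" by (simp add: n_def)
    finally show ?thesis unfolding sum by (simp add: add_nonneg_eq_0_iff)
  qed
  moreover have "real n * ballot_number (Suc m) k = real k * ((real m + real k + 2) * t)"
    using high by (simp add: ballot_number_def n_def)
  moreover have "real n * ballot_number m (k + 2) = (real k + 2) * ((real m + 1) * t)"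
    using low by (simp add: ballot_number_eq n_def add.assoc)
  moreover have "real k * ((real m + real k + 2) * t) + (real k + 2) * ((real m + 1) * t) =
      real n * ((real k + 1) * t)"
    by (simp add: n_def algebra_simps)
  ultimately have "real n * ballot_number (Suc m) (Suc k) =
      real n * (ballot_number (Suc m) k + ballot_number m (k + 2))"
    by (simp only: distrib_left)
  then show ?thesis by (simp add: n_def)
qed

lemma num_leaves_without_eggs_simps [simp]:
  "num_leaves_without_eggs (Leaf e) = (if e = 0 then 1 else 0)"
  "num_leaves_without_eggs (Inner e l r) = num_leaves_without_eggs l + num_leaves_without_eggs r"
  by (simp_all add: num_leaves_without_eggs_def)

text \<open>
  The index set is written as a condition so that it is empty for \<open>d < k\<close>, where the truncated
  \<open>(d - k) div 2\<close> would still admit \<open>m = 0\<close>. The recursion of the tree leads through this range.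
\<close>

lemma num_leaves_without_eggs_bonus_tree:
  "real (num_leaves_without_eggs (bonus_tree d k)) =
     (\<Sum>m\<le>d. if 2 * m + k \<le> d then ballot_number m k else 0)"
proof (induction d arbitrary: k)
  case 0
  show ?case by simp
next
  case (Suc d)
  show ?case
  proof (cases k)
    case 0
    have "(\<Sum>m\<le>Suc d. if 2 * m + k \<le> Suc d then ballot_number m k else 0) =
          (\<Sum>m\<le>Suc d. if m = 0 then 1 else 0)"
      using 0 by (intro sum.cong) (auto simp: ballot_number_start_0)
    with 0 show ?thesis by (simp del: sum.atMost_Suc)
  next
    case k: (Suc j)
    let ?f = "\<lambda>m. if 2 * m + j \<le> d then ballot_number m j else 0"
    let ?g = "\<lambda>m. if 2 * m + (j + 2) \<le> d then ballot_number m (j + 2) else 0"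
    let ?h = "\<lambda>m. if 2 * m + k \<le> Suc d then ballot_number m k else 0"
    have "?f (Suc d) = 0" by simp
    then have "sum ?f {..d} = sum ?f {..Suc d}" by simp
    also have "\<dots> = ?f 0 + (\<Sum>m\<le>d. ?f (Suc m))" by (rule sum.atMost_Suc_shift)
    finally have f: "sum ?f {..d} = ?f 0 + (\<Sum>m\<le>d. ?f (Suc m))" .
    \<comment> \<open>A first step up uses up one of the \<open>m\<close> steps up, hence the shifted index of \<open>?g\<close>.\<close>
    have "?h (Suc m) = ?f (Suc m) + ?g m" for m
      using k by (simp add: ballot_number_Suc[simplified])
    then have "(\<Sum>m\<le>d. ?h (Suc m)) = (\<Sum>m\<le>d. ?f (Suc m)) + sum ?g {..d}"
      by (simp only: sum.distrib)
    moreover have "?h 0 = ?f 0" using k by simp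
    moreover have "sum ?h {..Suc d} = ?h 0 + (\<Sum>m\<le>d. ?h (Suc m))"
      by (rule sum.atMost_Suc_shift)
    ultimately have "sum ?h {..Suc d} = sum ?f {..d} + sum ?g {..d}"
      using f by linarith
    moreover have "real (num_leaves_without_eggs (bonus_tree (Suc d) k)) =
        sum ?f {..d} + sum ?g {..d}"
      using k Suc.IH[of j] Suc.IH[of "j + 2"] by simp
    ultimately show ?thesis by simp
  qed
qed

corollary num_leaves_without_eggs_eq:
  assumes "1 \<le> k" "k \<le> d"
  shows "real (num_leaves_without_eggs (bonus_tree d k)) =
    (\<Sum>m = 0..(d - k) div 2. real k / real (2 * m + k) * real ((2 * m + k) choose m))"
proof -
  have "(\<Sum>m\<le>d. if 2 * m + k \<le> d then ballot_number m k else 0) =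
        (\<Sum>m | m \<in> {..d} \<and> 2 * m + k \<le> d. ballot_number m k)"
    by (rule sum.inter_filter[symmetric]) simp
  also have "{m. m \<in> {..d} \<and> 2 * m + k \<le> d} = {0..(d - k) div 2}"
    using assms by auto
  finally show ?thesis
    using assms by (simp add: num_leaves_without_eggs_bonus_tree ballot_number_eq)
qed

section \<open>Leaves with eggs\<close>

lemma num_leaves_with_eggs_simps [simp]:
  "num_leaves_with_eggs (Leaf e) = (if e = 0 then 0 else 1)"
  "num_leaves_with_eggs (Inner e l r) = num_leaves_with_eggs l + num_leaves_with_eggs r"
  by (simp_all add: num_leaves_with_eggs_def)

text \<open>Pascal's rule, applied to a weighted row.\<close>

lemma sum_choose_Suc_weighted:
  fixes w :: "nat \<Rightarrow> nat"
  shows "(\<Sum>n\<le>Suc d. w n * (Suc d choose n)) = (\<Sum>n\<le>d. (w n + w (Suc n)) * (d choose n))"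
proof -
  have "(\<Sum>n\<le>Suc d. w n * (Suc d choose n)) = w 0 + (\<Sum>n\<le>d. w (Suc n) * (Suc d choose Suc n))"
    by (subst sum.atMost_Suc_shift) simp
  also have "\<dots> = (\<Sum>n\<le>d. w (Suc n) * (d choose n)) +
      (w 0 + (\<Sum>n\<le>d. w (Suc n) * (d choose Suc n)))"
    by (simp add: sum.distrib algebra_simps)
  also have "w 0 + (\<Sum>n\<le>d. w (Suc n) * (d choose Suc n)) = (\<Sum>n\<le>Suc d. w n * (d choose n))"
    by (subst sum.atMost_Suc_shift) simp
  also have "\<dots> = (\<Sum>n\<le>d. w n * (d choose n))"
    by simp
  finally show ?thesis by (simp add: sum.distrib algebra_simps)
qed

text \<open>
  The window \<open>d - k \<le> 2 * n < d + k\<close> is empty for \<open>k = 0\<close> and contains the whole row for \<open>d < k\<close>.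
  Pascal's rule splits the window of \<open>d + 1\<close> and \<open>k\<close> into the windows \<open>[d - k + 1, d + k + 1)\<close> and
  \<open>[d - k - 1, d + k - 1)\<close> for \<open>2 * n\<close> in row \<open>d\<close>. Their union and intersection are the windows of
  \<open>k + 1\<close> and \<open>k - 1\<close>, which are those of the two subtrees.
\<close>

lemma num_leaves_with_eggs_bonus_tree:
  "num_leaves_with_eggs (bonus_tree d k) =
     (\<Sum>n\<le>d. of_bool (d \<le> 2 * n + k \<and> 2 * n < d + k) * (d choose n))"
proof (induction d arbitrary: k)
  case 0
  show ?case by simp
next
  case (Suc d)
  show ?case
  proof (cases k)
    case 0
    then show ?thesis by (auto intro!: sum.neutral[symmetric] simp del: sum.atMost_Suc)
  next
    case k: (Suc j)
    let ?win = "\<lambda>d k n. of_bool (d \<le> 2 * n + k \<and> 2 * n < d + k) :: nat"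
    have "?win (Suc d) k n + ?win (Suc d) k (Suc n) = ?win d j n + ?win d (j + 2) n" for n
      using k by (auto simp: of_bool_def)
    then have "(\<Sum>n\<le>Suc d. ?win (Suc d) k n * (Suc d choose n)) =
        (\<Sum>n\<le>d. (?win d j n + ?win d (j + 2) n) * (d choose n))"
      by (simp only: sum_choose_Suc_weighted)
    also have "\<dots> = (\<Sum>n\<le>d. ?win d j n * (d choose n)) + (\<Sum>n\<le>d. ?win d (j + 2) n * (d choose n))"
      by (simp only: sum.distrib distrib_right)
    also have "\<dots> = num_leaves_with_eggs (bonus_tree (Suc d) k)"
      using k Suc.IH[of j] Suc.IH[of "j + 2"] by simp
    finally show ?thesis by simp
  qed
qed

corollary num_leaves_with_eggs_eq:
  assumes "1 \<le> k" "k \<le> d"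
  defines "\<beta> \<equiv> (d - k + 1) div 2"
  shows "num_leaves_with_eggs (bonus_tree d k) = (\<Sum>n = \<beta>..\<beta> + k - 1. d choose n)"
proof -
  have "(\<Sum>n\<le>d. of_bool (d \<le> 2 * n + k \<and> 2 * n < d + k) * (d choose n)) =
        (\<Sum>n\<le>d. if d \<le> 2 * n + k \<and> 2 * n < d + k then d choose n else 0)"
    by (intro sum.cong) auto
  also have "\<dots> = (\<Sum>n | n \<in> {..d} \<and> d \<le> 2 * n + k \<and> 2 * n < d + k. d choose n)"
    by (rule sum.inter_filter[symmetric]) simp
  also have "{n. n \<in> {..d} \<and> d \<le> 2 * n + k \<and> 2 * n < d + k} = {\<beta>..\<beta> + k - 1}"
    using assms(1,2) unfolding \<beta>_def by auto
  finally show ?thesis by (simp add: num_leaves_with_eggs_bonus_tree)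
qed

section \<open>The height of the building\<close>

theorem theorem3p8:
  fixes k d :: nat
  assumes "k \<ge> 1"
  shows
    "(d < k \<longrightarrow>
        num_leaves (bonus_tree d k) = 2 ^ d \<and>
        num_inner (bonus_tree d k) = 2 ^ d - 1 \<and>
        H_bonus k d = 2 ^ d - 1) \<and>
     (k \<le> d \<longrightarrow>
        (let \<alpha> = (d - k) div 2; \<beta> = (d - k + 1) div 2 in
          real (num_leaves_without_eggs (bonus_tree d k)) =
            (\<Sum>m = 0..\<alpha>. real k / real (2 * m + k) * real ((2 * m + k) choose m)) \<and>
          num_leaves_with_eggs (bonus_tree d k) = (\<Sum>n = \<beta>..\<beta> + k - 1. d choose n) \<and>
          real (H_bonus k d) =
            (\<Sum>m = 1..\<alpha>. real k / real (2 * m + k) * real ((2 * m + k) choose m)) +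
            (\<Sum>n = \<beta>..\<beta> + k - 1. real (d choose n))))"
proof (intro conjI impI)
  assume "d < k"
  then have leaves: "num_leaves (bonus_tree d k) = 2 ^ d"
    by (simp add: num_leaves_complete)
  then have inner: "num_inner (bonus_tree d k) = 2 ^ d - 1"
    by (simp add: num_leaves_eq_Suc_num_inner)
  show "num_leaves (bonus_tree d k) = 2 ^ d" "num_inner (bonus_tree d k) = 2 ^ d - 1"
    "H_bonus k d = 2 ^ d - 1"
    using leaves inner by (simp_all add: H_bonus_eq_num_inner)
next
  assume "k \<le> d"
  define \<alpha> where "\<alpha> = (d - k) div 2"
  define \<beta> where "\<beta> = (d - k + 1) div 2"
  let ?c = "\<lambda>m. real k / real (2 * m + k) * real ((2 * m + k) choose m)"
  have Z: "real (num_leaves_without_eggs (bonus_tree d k)) = (\<Sum>m = 0..\<alpha>. ?c m)"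
    using num_leaves_without_eggs_eq[OF assms \<open>k \<le> d\<close>] by (simp add: \<alpha>_def)
  have M: "num_leaves_with_eggs (bonus_tree d k) = (\<Sum>n = \<beta>..\<beta> + k - 1. d choose n)"
    using num_leaves_with_eggs_eq[OF assms \<open>k \<le> d\<close>] by (simp add: \<beta>_def)
  have "Suc (H_bonus k d) =
      num_leaves_without_eggs (bonus_tree d k) + num_leaves_with_eggs (bonus_tree d k)"
    by (simp only: H_bonus_eq_num_inner flip: num_leaves_eq_Suc_num_inner num_leaves_split)
  then have "real (H_bonus k d) + 1 = real (num_leaves_without_eggs (bonus_tree d k)) +
      real (num_leaves_with_eggs (bonus_tree d k))"
    by (simp flip: of_nat_add)
  moreover have "(\<Sum>m = 0..\<alpha>. ?c m) = 1 + (\<Sum>m = 1..\<alpha>. ?c m)"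
    using assms by (simp add: sum.atLeast_Suc_atMost)
  ultimately have H: "real (H_bonus k d) =
      (\<Sum>m = 1..\<alpha>. ?c m) + (\<Sum>n = \<beta>..\<beta> + k - 1. real (d choose n))"
    by (simp add: Z M)
  show "let \<alpha> = (d - k) div 2; \<beta> = (d - k + 1) div 2 in
      real (num_leaves_without_eggs (bonus_tree d k)) = (\<Sum>m = 0..\<alpha>. ?c m) \<and>
      num_leaves_with_eggs (bonus_tree d k) = (\<Sum>n = \<beta>..\<beta> + k - 1. d choose n) \<and>
      real (H_bonus k d) =
        (\<Sum>m = 1..\<alpha>. ?c m) + (\<Sum>n = \<beta>..\<beta> + k - 1. real (d choose n))"
    unfolding Let_def \<alpha>_def[symmetric] \<beta>_def[symmetric] using Z M H by blast
qed

end
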